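(* Let $M,N\ge 1$ be integers, $T>0$ a real number, $y_1,\dots,y_M\in\{+1,-1\}$, and $H\in\{+1,-1\}^{M\times N}$ with rows $H_1,\dots,H_M$ and entries $H_{ij}$. The Lagrange dual of the ($\ell_1$-norm regularized) LogitBoost problem $$\min_{w\in\mathbb{R}^N,\ z\in\mathbb{R}^M}\ \sum_{i=1}^M\log\bigl(1+\exp(-z_i)\bigr)\quad\text{s.t.}\quad z_i=y_iH_iw\ (i=1,\dots,M),\quad w\ge0,\quad\mathbf{1}^\top w=\tfrac1T,$$ is the binary relative entropy maximization problem $$\max_{r\in\mathbb{R},\ u\in\mathbb{R}^M}\ \frac rT-\sum_{i=1}^M\bigl[(-u_i)\log(-u_i)+(1+u_i)\log(1+u_i)\bigr]\quad\text{s.t.}\quad\sum_{i=1}^M u_iy_iH_{ij}\ge r\ (j=1,\dots,N),$$ where $u$ is restricted to the domain of the objective, i.e. $-1\le u_i\le 0$ for all $i$.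
   Context: Setting: training examples $x_1,\dots,x_M$ with labels $y_i\in\{+1,-1\}$, weak classifiers $h_1,\dots,h_N$ with values in $\{+1,-1\}$, and $H_{ij}=h_j(x_i)$; the row vector $H_i=[H_{i1}\ \cdots\ H_{iN}]$ is the $i$-th row of $H$. Vector inequalities are componentwise, $\mathbf{1}$ is the all-ones vector, and $0\log0=0$. The Lagrange dual is formed with the Lagrangian $$L(w,z,u,q,r)=\sum_{i=1}^M\log\bigl(1+\exp(-z_i)\bigr)-\sum_{i=1}^M u_i(z_i-y_iH_iw)-q^\top w-r\bigl(\mathbf{1}^\top w-\tfrac1T\bigr),$$ with multipliers $u\in\mathbb{R}^M$, $q\in\mathbb{R}^N$ with $q\ge0$, and $r\in\mathbb{R}$. The dual function is $g(u,q,r)=\inf_{w\in\mathbb{R}^N,z\in\mathbb{R}^M}L(w,z,u,q,r)\in[-\infty,\infty)$, and the dual problem is to maximize $g(u,q,r)$ over $u$, $r$ and $q\ge0$. "The dual is" the stated problem means: after making the condition $g>-\infty$ explicit as constraints and eliminating $q$, the dual problem becomes the stated one. That is, for every $(u,r)$, $\sup_{q\ge 0}g(u,q,r)$ equals the stated objective if $(u,r)$ satisfies the stated constraints (including $-1\le u_i\le0$), and equals $-\infty$ otherwise. *)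

theory Defs
  imports "HOL-Analysis.Analysis"
begin

text \<open>
  Lagrange duality for a problem \<open>min f x\<close> subject to \<open>c x = 0\<close> and \<open>d x \<ge> 0\<close>, where \<open>c\<close> collects
  all equality residuals in one inner product space and \<open>d\<close> is vector valued
  (the order on \<^typ>\<open>real^'k\<close> is componentwise).
  With a product space such as \<^typ>\<open>(real^'m) \<times> real\<close> as the codomain of \<open>c\<close>, the multiplier is a pair
  and \<open>(u, r) \<bullet> (a, b) = u \<bullet> a + r * b\<close>.
\<close>

definition lagrangian ::
    "('x \<Rightarrow> real) \<Rightarrow> ('x \<Rightarrow> 'e::real_inner) \<Rightarrow> ('x \<Rightarrow> real^'k) \<Rightarrow> 'x \<Rightarrow> 'e \<Rightarrow> real^'k \<Rightarrow> real" where
  "lagrangian f c d x \<nu> q = f x - \<nu> \<bullet> c x - q \<bullet> d x"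

definition dual_function ::
    "('x \<Rightarrow> real) \<Rightarrow> ('x \<Rightarrow> 'e::real_inner) \<Rightarrow> ('x \<Rightarrow> real^'k) \<Rightarrow> 'e \<Rightarrow> real^'k \<Rightarrow> ereal" where
  "dual_function f c d \<nu> q = (INF x. ereal (lagrangian f c d x \<nu> q))"


text \<open>The LogitBoost problem in the variable \<open>(w, z)\<close>.\<close>

definition logit_objective :: "(real^'n) \<times> (real^'m) \<Rightarrow> real" where
  "logit_objective = (\<lambda>(w, z). \<Sum>i\<in>UNIV. ln (1 + exp (- z $ i)))"

definition logit_eq ::
    "real \<Rightarrow> real^'m \<Rightarrow> real^'n^'m \<Rightarrow> (real^'n) \<times> (real^'m) \<Rightarrow> (real^'m) \<times> real" where
  "logit_eq T y H = (\<lambda>(w, z). (\<chi> i. z $ i - y $ i * (H $ i \<bullet> w), (\<Sum>j\<in>UNIV. w $ j) - 1 / T))"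

definition logit_ineq :: "(real^'n) \<times> (real^'m) \<Rightarrow> real^'n" where
  "logit_ineq = (\<lambda>(w, z). w)"

lemma logit_constraints:
  "logit_eq T y H (w, z) = 0 \<and> 0 \<le> logit_ineq (w, z) \<longleftrightarrow>
    (\<forall>i. z $ i = y $ i * (H $ i \<bullet> w)) \<and> (\<forall>j. 0 \<le> w $ j) \<and> (\<Sum>j\<in>UNIV. w $ j) = 1 / T"
  by (auto simp: logit_eq_def logit_ineq_def zero_prod_def vec_eq_iff less_eq_vec_def)

lemma logit_lagrangian:
  "lagrangian logit_objective (logit_eq T y H) logit_ineq (w, z) (u, r) q =
    (\<Sum>i\<in>UNIV. ln (1 + exp (- z $ i))) - (\<Sum>i\<in>UNIV. u $ i * (z $ i - y $ i * (H $ i \<bullet> w)))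
      - q \<bullet> w - r * ((\<Sum>j\<in>UNIV. w $ j) - 1 / T)"
  by (simp add: lagrangian_def logit_objective_def logit_eq_def logit_ineq_def
      inner_vec_def[of u])


text \<open>
  The binary relative entropy problem. The convention \<open>0 log 0 = 0\<close> holds because of the factor \<open>0\<close>.
\<close>

definition entropy_objective :: "real \<Rightarrow> real^'m \<Rightarrow> real \<Rightarrow> real" where
  "entropy_objective T u r =
    r / T - (\<Sum>i\<in>UNIV. (- u $ i) * ln (- u $ i) + (1 + u $ i) * ln (1 + u $ i))"

definition entropy_feasible :: "real^'m \<Rightarrow> real^'n^'m \<Rightarrow> real^'m \<Rightarrow> real \<Rightarrow> bool" where
  "entropy_feasible y H u r \<longleftrightarrow>
    (\<forall>j. (\<Sum>i\<in>UNIV. u $ i * y $ i * H $ i $ j) \<ge> r) \<and> (\<forall>i. -1 \<le> u $ i \<and> u $ i \<le> 0)"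

end

theory Submission
  imports Defs
begin

text \<open>
  The Lagrangian is a sum of one-dimensional terms: \<open>log (1 + exp (- z\<^sub>i)) - u\<^sub>i z\<^sub>i\<close> for each
  example and a linear term in each \<open>w\<^sub>j\<close> with slope \<open>(\<Sum>i. u\<^sub>i y\<^sub>i H\<^sub>i\<^sub>j) - r - q\<^sub>j\<close>. The linear terms
  are bounded below only if all slopes vanish, which determines \<open>q \<ge> 0\<close> and gives the constraint.
  With \<open>p = - u\<^sub>i\<close>, the infimum of the logistic term is the binary entropy of \<open>p\<close> by Gibbs' inequality
  if \<open>0 \<le> p \<le> 1\<close>, and it is \<open>-\<infinity>\<close> otherwise.
\<close>

definition tilted_logistic :: "real \<Rightarrow> real \<Rightarrow> real" where
  "tilted_logistic p z = ln (1 + exp (- z)) + p * z"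

definition binary_entropy :: "real \<Rightarrow> real" where
  "binary_entropy p = - (p * ln p + (1 - p) * ln (1 - p))"

text \<open>Symmetry of the logistic loss under exchanging the two labels. It reduces
  \<open>p = 1\<close> to \<open>p = 0\<close> and \<open>p > 1\<close> to
  \<open>p < 0\<close>.\<close>

lemma tilted_logistic_reflect: "tilted_logistic (1 - p) (- z) = tilted_logistic p z"
proof -
  have "1 + exp z = exp z * (1 + exp (- z))"
    by (simp add: distrib_left exp_minus)
  moreover have "1 + exp (- z) > 0"
    by (simp add: add_pos_pos)
  ultimately have "ln (1 + exp z) = z + ln (1 + exp (- z))"
    by (simp add: ln_mult_pos)
  then show ?thesis
    by (simp add: tilted_logistic_def algebra_simps)
qed

lemma binary_entropy_reflect: "binary_entropy (1 - p) = binary_entropy p"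
  by (simp add: binary_entropy_def)

text \<open>One summand of Gibbs' inequality: the tangent bound \<open>ln x \<le> x - 1\<close> at
  \<open>x = b / a\<close>, scaled by \<open>a\<close>. When \<open>a\<close> and \<open>b\<close>
  run over two probability distributions, the right-hand sides add up to zero.\<close>

lemma mult_ln_diff_le:
  fixes a b :: real
  assumes "0 \<le> a" "0 < b"
  shows "a * ln b - a * ln a \<le> b - a"
proof (cases "a = 0")
  case False
  then have "a > 0" using assms by simp
  have "a * ln (b / a) \<le> a * (b / a - 1)"
    using assms \<open>a > 0\<close> by (intro mult_left_mono ln_le_minus_one) auto
  then show ?thesis
    using assms \<open>a > 0\<close> by (simp add: ln_div right_diff_distrib)
qed (use assms in simp)

text \<open>With \<open>E = exp (- z)\<close>, the right-hand side is the cross entropy of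
  \<open>(p, 1 - p)\<close> relative to the logistic distribution
  \<open>(E / (1 + E), 1 / (1 + E))\<close>, so Gibbs' inequality applies.\<close>

lemma binary_entropy_le_tilted_logistic:
  assumes "0 \<le> p" "p \<le> 1"
  shows "binary_entropy p \<le> tilted_logistic p z"
proof -
  define E where "E = exp (- z)"
  have E: "E > 0" "ln E = - z" by (auto simp: E_def)
  have ln_E: "ln (E / (1 + E)) = - z - ln (1 + E)" "ln (1 / (1 + E)) = - ln (1 + E)"
    using E by (simp_all add: ln_div)
  have "p * ln (E / (1 + E)) - p * ln p \<le> E / (1 + E) - p"
    using assms E by (intro mult_ln_diff_le) auto
  moreover have "(1 - p) * ln (1 / (1 + E)) - (1 - p) * ln (1 - p) \<le> 1 / (1 + E) - (1 - p)"
    using assms E by (intro mult_ln_diff_le) auto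
  moreover have "E / (1 + E) + 1 / (1 + E) = 1"
    using E by (simp flip: add_divide_distrib)
  ultimately show ?thesis
    unfolding ln_E binary_entropy_def tilted_logistic_def E_def[symmetric]
    by (simp add: algebra_simps)
qed

lemma tilted_logistic_0_small:
  assumes "e > 0"
  shows "\<exists>z. tilted_logistic 0 z < e"
proof -
  have "ln (1 + exp (- (- ln (e / 2)))) \<le> e / 2"
    using assms ln_add_one_self_le_self[of "e / 2"] by simp
  also have "\<dots> < e" using assms by simp
  finally show ?thesis
    unfolding tilted_logistic_def by (intro exI[of _ "- ln (e / 2)"]) simp
qed

text \<open>The slack \<open>e\<close> is unavoidable: for \<open>p = 0\<close> and
  \<open>p = 1\<close> the infimum is only approached, as \<open>z\<close> tends to plus or minus
  infinity.\<close>

lemma tilted_logistic_near_binary_entropy: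
  assumes "0 \<le> p" "p \<le> 1" "e > 0"
  shows "\<exists>z. tilted_logistic p z < binary_entropy p + e"
proof -
  consider "p = 0" | "p = 1" | "0 < p" "p < 1" using assms by linarith
  then show ?thesis
  proof cases
    case 1
    then show ?thesis
      using tilted_logistic_0_small[OF \<open>e > 0\<close>] by (simp add: binary_entropy_def)
  next
    case 2
    obtain z where "tilted_logistic 0 z < e"
      using tilted_logistic_0_small[OF \<open>e > 0\<close>] by blast
    then have "tilted_logistic p (- z) < binary_entropy p + e"
      using 2 tilted_logistic_reflect[of 0 z] by (simp add: binary_entropy_def)
    then show ?thesis ..
  next
    case 3
    \<comment> \<open>The log-odds at which the logistic distribution equals
      \<open>(p, 1 - p)\<close>, the equality case of Gibbs' inequality.\<close>
    define z where "z = ln (1 - p) - ln p"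
    have "exp (- z) = p / (1 - p)"
      using 3 by (simp add: z_def exp_diff)
    then have "1 + exp (- z) = 1 / (1 - p)"
      using 3 by (simp add: field_simps)
    then have "tilted_logistic p z = binary_entropy p"
      using 3 by (simp add: tilted_logistic_def binary_entropy_def z_def ln_div algebra_simps)
    then show ?thesis using \<open>e > 0\<close> by (intro exI[of _ z]) simp
  qed
qed

lemma tilted_logistic_neg_unbounded:
  assumes "p < 0"
  shows "\<exists>z. tilted_logistic p z \<le> B"
proof -
  \<comment> \<open>The \<open>max\<close> with 0 keeps the logarithm below \<open>ln 2\<close>; the
    other argument makes \<open>p * z\<close> at most \<open>B - ln 2\<close>.\<close>
  define z where "z = max 0 ((B - ln 2) / p)"
  have "ln (1 + exp (- z)) \<le> ln 2"
    by (simp add: z_def add_pos_pos)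
  moreover have "p * z \<le> p * ((B - ln 2) / p)"
    using assms by (intro mult_left_mono_neg) (auto simp: z_def)
  ultimately have "tilted_logistic p z \<le> B"
    using assms by (simp add: tilted_logistic_def)
  then show ?thesis ..
qed

lemma tilted_logistic_unbounded:
  assumes "\<not> (0 \<le> p \<and> p \<le> 1)"
  shows "\<exists>z. tilted_logistic p z \<le> B"
proof (cases "p < 0")
  case False
  then have "1 - p < 0" using assms by simp
  then obtain z where "tilted_logistic (1 - p) z \<le> B"
    using tilted_logistic_neg_unbounded by blast
  then have "tilted_logistic p (- z) \<le> B"
    using tilted_logistic_reflect[of p "- z"] by simp
  then show ?thesis ..
qed (rule tilted_logistic_neg_unbounded)

lemma logit_lagrangian_separated:
  fixes T r :: real and y u z :: "real^'m" and H :: "real^'n^'m" and w q :: "real^'n"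
  shows "lagrangian logit_objective (logit_eq T y H) logit_ineq (w, z) (u, r) q =
    r / T + (\<Sum>i\<in>UNIV. tilted_logistic (- u $ i) (z $ i))
      + (\<Sum>j\<in>UNIV. ((\<Sum>i\<in>UNIV. u $ i * y $ i * H $ i $ j) - r - q $ j) * w $ j)"
proof -
  have "(\<Sum>i\<in>UNIV. u $ i * (y $ i * (H $ i \<bullet> w)))
      = (\<Sum>i\<in>UNIV. \<Sum>j\<in>UNIV. u $ i * y $ i * H $ i $ j * w $ j)"
    by (simp add: inner_vec_def sum_distrib_left mult.assoc)
  also have "\<dots> = (\<Sum>j\<in>UNIV. (\<Sum>i\<in>UNIV. u $ i * y $ i * H $ i $ j) * w $ j)"
    by (subst sum.swap) (simp add: sum_distrib_right)
  finally show ?thesis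
    unfolding logit_lagrangian
    by (simp add: tilted_logistic_def inner_vec_def[of q] right_diff_distrib left_diff_distrib
        sum.distrib sum_subtractf sum_negf sum_distrib_left)
qed

lemma entropy_objective_binary_entropy:
  "entropy_objective T u r = r / T + (\<Sum>i\<in>UNIV. binary_entropy (- u $ i))"
  by (simp add: entropy_objective_def binary_entropy_def sum_negf[symmetric] sum_subtractf)

lemma dual_function_eq_MInf:
  assumes "\<And>B. \<exists>x. lagrangian f c d x \<nu> q \<le> B"
  shows "dual_function f c d \<nu> q = - \<infinity>"
proof (rule ereal_bot)
  fix B
  obtain x where "lagrangian f c d x \<nu> q \<le> B" using assms by blast
  then show "dual_function f c d \<nu> q \<le> ereal B"
    unfolding dual_function_def by (intro INF_lower2[of x]) auto
qed

lemma logit_dual_infeasible: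
  assumes "\<not> entropy_feasible y H u r" "0 \<le> q"
  shows "dual_function logit_objective (logit_eq T y H) logit_ineq (u, r) q = - \<infinity>"
proof (rule dual_function_eq_MInf)
  fix B
  let ?L = "\<lambda>w z. lagrangian logit_objective (logit_eq T y H) logit_ineq (w, z) (u, r) q"
  let ?a = "\<lambda>j. \<Sum>i\<in>UNIV. u $ i * y $ i * H $ i $ j"
  consider i where "\<not> (-1 \<le> u $ i \<and> u $ i \<le> 0)" | j where "?a j < r"
    using assms(1) by (auto simp: entropy_feasible_def not_le)
  then have "\<exists>w z. ?L w z \<le> B"
  proof cases
    case (1 i)
    \<comment> \<open>The contribution of everything held fixed: \<open>w = 0\<close> and all
      coordinates of \<open>z\<close> other than \<open>i\<close> equal to 0.\<close>
    let ?C = "r / T + (\<Sum>k\<in>UNIV - {i}. tilted_logistic (- u $ k) 0)"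
    obtain t where t: "tilted_logistic (- u $ i) t \<le> B - ?C"
      using 1 tilted_logistic_unbounded[of "- u $ i"] by force
    have "(\<Sum>k\<in>UNIV. tilted_logistic (- u $ k) (axis i t $ k))
        = tilted_logistic (- u $ i) t + (\<Sum>k\<in>UNIV - {i}. tilted_logistic (- u $ k) 0)"
      by (subst sum.remove[of _ i]) (auto simp: axis_def intro!: sum.cong)
    then have "?L 0 (axis i t) \<le> B"
      using t by (simp add: logit_lagrangian_separated)
    then show ?thesis by blast
  next
    case (2 j)
    let ?C = "r / T + (\<Sum>i\<in>UNIV. tilted_logistic (- u $ i) 0)"
    have "0 \<le> q $ j" using assms(2) by (simp add: less_eq_vec_def)
    \<comment> \<open>Subtracting \<open>q $ j \<ge> 0\<close> only lowers the slope, so no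
      admissible \<open>q\<close> repairs a violated constraint.\<close>
    then have slope: "?a j - r - q $ j < 0" using 2 by simp
    \<comment> \<open>Solves \<open>slope * t = B - ?C\<close>; either sign of \<open>?t\<close> is
      fine, since \<open>w\<close> is unrestricted in the Lagrangian.\<close>
    let ?t = "(B - ?C) / (?a j - r - q $ j)"
    have "(\<Sum>k\<in>UNIV. (?a k - r - q $ k) * axis j ?t $ k) = (?a j - r - q $ j) * ?t"
      by (subst sum.remove[of _ j]) (auto simp: axis_def intro!: sum.neutral)
    also have "\<dots> = B - ?C" using slope by simp
    finally have "?L (axis j ?t) 0 \<le> B"
      by (simp add: logit_lagrangian_separated)
    then show ?thesis by blast
  qed
  then show "\<exists>x. lagrangian logit_objective (logit_eq T y H) logit_ineq x (u, r) q \<le> B"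
    by blast
qed

text \<open>Evaluating at \<open>w = 0\<close> removes the linear terms, so the bound is uniform in
  \<open>q\<close>. The tolerance \<open>e\<close> is shared equally among the examples.\<close>

lemma logit_dual_le_entropy:
  fixes y u :: "real^'m" and H :: "real^'n^'m"
  assumes "\<And>i. -1 \<le> u $ i \<and> u $ i \<le> 0"
  shows "dual_function logit_objective (logit_eq T y H) logit_ineq (u, r) q
    \<le> ereal (entropy_objective T u r)"
proof (rule ereal_le_epsilon2)
  fix e :: real
  assume "e > 0"
  then have "\<exists>z. tilted_logistic (- u $ i) z < binary_entropy (- u $ i) + e / CARD('m)" for i
    using assms[of i] by (intro tilted_logistic_near_binary_entropy) auto
  then obtain z where
    z: "tilted_logistic (- u $ i) (z i) < binary_entropy (- u $ i) + e / CARD('m)" for i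
    by metis
  let ?z = "\<chi> i. z i"
  have "(\<Sum>i\<in>UNIV. tilted_logistic (- u $ i) (z i))
      \<le> (\<Sum>i\<in>UNIV. binary_entropy (- u $ i) + e / CARD('m))"
    by (intro sum_mono less_imp_le z)
  also have "\<dots> = (\<Sum>i\<in>UNIV. binary_entropy (- u $ i)) + e"
    by (simp add: sum.distrib)
  finally have "lagrangian logit_objective (logit_eq T y H) logit_ineq (0, ?z) (u, r) q
      \<le> entropy_objective T u r + e"
    by (simp add: logit_lagrangian_separated entropy_objective_binary_entropy)
  then show "dual_function logit_objective (logit_eq T y H) logit_ineq (u, r) q
      \<le> ereal (entropy_objective T u r) + ereal e"
    unfolding dual_function_def by (intro INF_lower2[of "(0, ?z)"]) auto
qed

text \<open>This \<open>q\<close> makes every slope zero, so \<open>w\<close> drops out of the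
  Lagrangian and Gibbs' inequality bounds each remaining term.\<close>

lemma entropy_le_logit_dual:
  fixes y u :: "real^'m" and H :: "real^'n^'m"
  assumes "\<And>i. -1 \<le> u $ i \<and> u $ i \<le> 0"
    and q: "\<And>j. q $ j = (\<Sum>i\<in>UNIV. u $ i * y $ i * H $ i $ j) - r"
  shows "ereal (entropy_objective T u r)
    \<le> dual_function logit_objective (logit_eq T y H) logit_ineq (u, r) q"
  unfolding dual_function_def
proof (rule INF_greatest)
  fix x :: "(real^'n) \<times> (real^'m)"
  obtain w z where x: "x = (w, z)" by fastforce
  have "(\<Sum>i\<in>UNIV. binary_entropy (- u $ i)) \<le> (\<Sum>i\<in>UNIV. tilted_logistic (- u $ i) (z $ i))"
    using assms(1) by (intro sum_mono binary_entropy_le_tilted_logistic) force+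
  then show "ereal (entropy_objective T u r)
      \<le> ereal (lagrangian logit_objective (logit_eq T y H) logit_ineq x (u, r) q)"
    by (simp add: x logit_lagrangian_separated entropy_objective_binary_entropy q)
qed

theorem theorem3p2:
  fixes T r :: real and y u :: "real^'m" and H :: "real^'n^'m"
  assumes "T > 0"
    and "\<And>i. y $ i \<in> {1, -1}"
    and "\<And>i j. H $ i $ j \<in> {1, -1}"
  shows "(SUP q\<in>{q. 0 \<le> q}. dual_function logit_objective (logit_eq T y H) logit_ineq (u, r) q) =
    (if entropy_feasible y H u r then ereal (entropy_objective T u r) else - \<infinity>)"
proof (cases "entropy_feasible y H u r")
  case True
  then have u: "\<And>i. -1 \<le> u $ i \<and> u $ i \<le> 0"
    and a: "\<And>j. r \<le> (\<Sum>i\<in>UNIV. u $ i * y $ i * H $ i $ j)"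
    by (auto simp: entropy_feasible_def)
  \<comment> \<open>The slack of the entropy constraints: nonnegative by feasibility, and a
    maximizer, since the upper bound holds for every \<open>q\<close>.\<close>
  define q :: "real^'n" where "q = (\<chi> j. (\<Sum>i\<in>UNIV. u $ i * y $ i * H $ i $ j) - r)"
  have "0 \<le> q" using a by (simp add: q_def less_eq_vec_def)
  moreover have "ereal (entropy_objective T u r)
      \<le> dual_function logit_objective (logit_eq T y H) logit_ineq (u, r) q"
    by (intro entropy_le_logit_dual u) (simp add: q_def)
  ultimately have "ereal (entropy_objective T u r)
      \<le> (SUP q\<in>{q. 0 \<le> q}. dual_function logit_objective (logit_eq T y H) logit_ineq (u, r) q)"
    by (intro SUP_upper2[of q]) auto
  moreover have "(SUP q\<in>{q. 0 \<le> q}. dual_function logit_objective (logit_eq T y H) logit_ineq (u, r) q)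
      \<le> ereal (entropy_objective T u r)"
    by (intro SUP_least logit_dual_le_entropy u)
  ultimately show ?thesis using True by (simp add: antisym)
next
  case False
  have "(SUP q\<in>{q. 0 \<le> q}. dual_function logit_objective (logit_eq T y H) logit_ineq (u, r) q)
      \<le> - \<infinity>"
    by (rule SUP_least) (simp add: logit_dual_infeasible[OF False])
  then show ?thesis using False by simp
qed

end
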